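(* Let $X\neq\{0\}$ and $Y$ be Banach spaces such that $Y$ contains an isometric copy of $\ell_q$ for some $1\leq q<\infty$. If $\mathcal{L}(X;\ell_q)\neq\mathcal{NA}(X;\ell_q)$ (for this same $q$), then $\mathcal{L}(X;Y)\setminus\mathcal{NA}(X;Y)$ is lineable in $\mathcal{L}(X;Y)$.
   Context: $X$ and $Y$ are Banach spaces over the same scalar field. $\mathcal{L}(X;Y)$ is the space of all bounded linear operators from $X$ to $Y$ with the operator norm $\|T\|=\sup\{\|T(x)\|_Y:\|x\|_X=1\}$. $\mathcal{NA}(X;Y)$ is the subset of all norm-attaining operators, i.e. those $T\in\mathcal{L}(X;Y)$ for which there is $v\in X$ with $\|v\|_X=1$ and $\|T(v)\|_Y=\|T\|$. "$Y$ contains an isometric copy of $\ell_q$" means there is a linear isometric embedding $\ell_q\to Y$, where $\ell_q$ is the usual space of $q$-summable scalar sequences. A subset $A$ of an infinite-dimensional vector space $V$ is lineable (in $V$) if $A\cup\{0\}$ contains an infinite-dimensional linear subspace of $V$. *)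

theory Defs
  imports "HOL-Analysis.Analysis" "HOL-Library.Function_Algebras"
begin

section \<open>Banach spaces over the real or the complex numbers\<close>

text \<open>The scalar field is any type of class \<^class>\<open>real_normed_field\<close>. Such a field has a
  multiplicative norm and contains the reals, so by the Gelfand--Mazur theorem it is the real or
  the complex field; \<^typ>\<open>real\<close> and \<^typ>\<open>complex\<close> are both instances. Completeness and the norm
  come from the class \<^class>\<open>banach\<close>, whose real scalar multiplication has to be the
  restriction of \<open>scale\<close> to real scalars.\<close>

locale banach_space_over = vector_space scale
  for scale :: "'k::real_normed_field \<Rightarrow> 'a::banach \<Rightarrow> 'a" +
  assumes norm_scale: "norm (scale c x) = norm c * norm x"
    and scale_of_real: "scale (of_real r) x = r *\<^sub>R x"

lemma banach_space_over_real: "banach_space_over (scaleR :: real \<Rightarrow> 'a::banach \<Rightarrow> 'a)"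
  by unfold_locales (auto simp: algebra_simps)

lemma banach_space_over_self:
  "banach_space_over ((*) :: 'k::{real_normed_field,banach} \<Rightarrow> 'k \<Rightarrow> 'k)"
  by unfold_locales (auto simp: algebra_simps norm_mult scaleR_conv_of_real)

text \<open>Functions form a vector space under the pointwise operations (the additive structure is that
  of \<^theory>\<open>HOL-Library.Function_Algebras\<close>). This is used for scalar sequences and for operators.\<close>

definition fun_scale :: "('k \<Rightarrow> 'b \<Rightarrow> 'b) \<Rightarrow> 'k \<Rightarrow> ('a \<Rightarrow> 'b) \<Rightarrow> 'a \<Rightarrow> 'b" where
  "fun_scale s c f = (\<lambda>x. s c (f x))"

lemma vector_space_fun_scale:
  assumes "vector_space s"
  shows "vector_space (fun_scale s)"
proof -
  interpret vector_space s by fact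
  show ?thesis
    by unfold_locales (auto simp: fun_scale_def fun_eq_iff algebra_simps)
qed


section \<open>The sequence space\<close>

definition ell :: "real \<Rightarrow> (nat \<Rightarrow> 'k::real_normed_field) set" where
  "ell q = {x. summable (\<lambda>n. norm (x n) powr q)}"

definition ell_norm :: "real \<Rightarrow> (nat \<Rightarrow> 'k::real_normed_field) \<Rightarrow> real" where
  "ell_norm q x = (\<Sum>n. norm (x n) powr q) powr (1 / q)"

abbreviation seq_scale :: "'k::real_normed_field \<Rightarrow> (nat \<Rightarrow> 'k) \<Rightarrow> nat \<Rightarrow> 'k" where
  "seq_scale \<equiv> fun_scale (*)"

definition isometric_ell_embedding ::
  "real \<Rightarrow> ('k::real_normed_field \<Rightarrow> 'b::real_normed_vector \<Rightarrow> 'b) \<Rightarrow> ((nat \<Rightarrow> 'k) \<Rightarrow> 'b) \<Rightarrow> bool" where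
  "isometric_ell_embedding q s J \<longleftrightarrow>
     (\<forall>x\<in>ell q. \<forall>y\<in>ell q. J (x + y) = J x + J y) \<and>
     (\<forall>c. \<forall>x\<in>ell q. J (seq_scale c x) = s c (J x)) \<and>
     (\<forall>x\<in>ell q. norm (J x) = ell_norm q x)"


section \<open>Bounded and norm-attaining operators\<close>

text \<open>The domain is a whole type. The codomain is given by its carrier \<open>W\<close>, scalar
  multiplication \<open>s'\<close> and norm \<open>N\<close>, because the sequence space depends on the real number \<open>q\<close> and
  is therefore a set and not a type.\<close>

definition bounded_operators ::
  "('k::real_normed_field \<Rightarrow> 'a::real_normed_vector \<Rightarrow> 'a) \<Rightarrow>
   'b set \<Rightarrow> ('k \<Rightarrow> 'b::ab_group_add \<Rightarrow> 'b) \<Rightarrow> ('b \<Rightarrow> real) \<Rightarrow> ('a \<Rightarrow> 'b) set" where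
  "bounded_operators s W s' N =
     {T. Vector_Spaces.linear s s' T \<and> range T \<subseteq> W \<and> (\<exists>K. \<forall>x. N (T x) \<le> K * norm x)}"

definition operator_norm :: "('b \<Rightarrow> real) \<Rightarrow> ('a::real_normed_vector \<Rightarrow> 'b) \<Rightarrow> real" where
  "operator_norm N T = Sup {N (T x) |x. norm x = 1}"

definition norm_attaining_operators ::
  "('k::real_normed_field \<Rightarrow> 'a::real_normed_vector \<Rightarrow> 'a) \<Rightarrow>
   'b set \<Rightarrow> ('k \<Rightarrow> 'b::ab_group_add \<Rightarrow> 'b) \<Rightarrow> ('b \<Rightarrow> real) \<Rightarrow> ('a \<Rightarrow> 'b) set" where
  "norm_attaining_operators s W s' N =
     {T \<in> bounded_operators s W s' N. \<exists>v. norm v = 1 \<and> N (T v) = operator_norm N T}"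

lemma bounded_operators_real:
  "bounded_operators scaleR UNIV scaleR norm
     = {T :: 'a::real_normed_vector \<Rightarrow> 'b::real_normed_vector. bounded_linear T}"
proof -
  have "bounded_linear T \<longleftrightarrow>
      Vector_Spaces.linear scaleR scaleR T \<and> (\<exists>K. \<forall>x. norm (T x) \<le> K * norm x)"
    for T :: "'a \<Rightarrow> 'b"
    by (simp add: bounded_linear_def bounded_linear_axioms_def linear_def mult.commute)
  then show ?thesis
    by (auto simp: bounded_operators_def)
qed

lemma operator_norm_eq_onorm:
  fixes T :: "'a::real_normed_vector \<Rightarrow> 'b::real_normed_vector"
  assumes T: "bounded_linear T" and nz: "\<exists>x::'a. x \<noteq> 0"
  shows "operator_norm norm T = onorm T"
proof -
  obtain z :: 'a where z: "norm z = 1"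
    using nz by (metis norm_sgn)
  interpret bounded_linear T by fact
  have le: "norm (T x) \<le> onorm T" if "norm x = 1" for x
    using onorm [OF T, of x] that by simp
  have bdd: "bdd_above {norm (T x) |x. norm x = 1}"
    using le by (intro bdd_aboveI[of _ "onorm T"]) auto
  have upper: "norm (T x) \<le> operator_norm norm T" if "norm x = 1" for x
    unfolding operator_norm_def using that by (intro cSup_upper bdd) auto
  have "0 \<le> operator_norm norm T"
    using upper [OF z] norm_ge_zero order_trans by blast
  moreover have "norm (T x) \<le> operator_norm norm T * norm x" for x
  proof (cases "x = 0")
    case False
    then show ?thesis
      using upper [of "sgn x"] by (simp add: norm_sgn sgn_div_norm scaleR field_simps)
  qed (simp add: zero)
  ultimately have "onorm T \<le> operator_norm norm T"
    by (rule onorm_bound)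
  moreover have "operator_norm norm T \<le> onorm T"
    unfolding operator_norm_def using z le by (intro cSup_least) auto
  ultimately show ?thesis
    by simp
qed


section \<open>Lineability\<close>

definition infinite_dimensional :: "('k::field \<Rightarrow> 'v::ab_group_add \<Rightarrow> 'v) \<Rightarrow> 'v set \<Rightarrow> bool" where
  "infinite_dimensional s V \<longleftrightarrow> \<not> (\<exists>B. finite B \<and> module.span s B = V)"

text \<open>\<open>V\<close> is the ambient vector space, a linear subspace of the type of its vectors.\<close>

definition lineable_in ::
  "('k::field \<Rightarrow> 'v::ab_group_add \<Rightarrow> 'v) \<Rightarrow> 'v set \<Rightarrow> 'v set \<Rightarrow> bool" where
  "lineable_in s V A \<longleftrightarrow>
     vector_space s \<and> module.subspace s V \<and> infinite_dimensional s V \<and> A \<subseteq> V \<and>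
     (\<exists>W. module.subspace s W \<and> infinite_dimensional s W \<and> W \<subseteq> A \<union> {0})"

end

theory Submission
  imports Defs
begin

text \<open>Let \<open>T\<close> be an operator into the sequence space that does not attain its norm, and let \<open>J\<close> be
  the isometric embedding. For a finitely supported sequence \<open>a\<close> let \<open>a \<otimes> y\<close> be the doubly indexed
  sequence \<open>(a i * y j)\<close>, re-indexed by the natural numbers. Its norm is the product of the norms of
  \<open>a\<close> and \<open>y\<close>. Hence \<open>x \<mapsto> J (a \<otimes> T x)\<close> has norm function proportional to that of \<open>T\<close>, so it attains
  its norm only if \<open>a = 0\<close>; and it depends linearly and injectively on \<open>a\<close>.\<close>

section \<open>Finitely supported sequences and the tensor product\<close>

text \<open>Finite support places these sequences in \<open>ell q\<close> for every \<open>q\<close>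
  at once and makes infinite dimension elementary: finitely many of them never reach all
  coordinates.\<close>

definition finsupp :: "(nat \<Rightarrow> 'k::zero) set" where
  "finsupp = {a. finite {n. a n \<noteq> 0}}"

definition tensor :: "(nat \<Rightarrow> 'k::times) \<Rightarrow> (nat \<Rightarrow> 'k) \<Rightarrow> nat \<Rightarrow> 'k" where
  "tensor a y = (\<lambda>n. a (fst (prod_decode n)) * y (snd (prod_decode n)))"

lemma finsupp_zero: "0 \<in> finsupp"
  by (simp add: finsupp_def)

lemma finsupp_add:
  fixes a b :: "nat \<Rightarrow> 'k::monoid_add"
  assumes "a \<in> finsupp" "b \<in> finsupp"
  shows "a + b \<in> finsupp"
proof -
  have "{n. (a + b) n \<noteq> 0} \<subseteq> {n. a n \<noteq> 0} \<union> {n. b n \<noteq> 0}"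
    by auto
  moreover have "finite ({n. a n \<noteq> 0} \<union> {n. b n \<noteq> 0})"
    using assms by (simp add: finsupp_def)
  ultimately show ?thesis
    unfolding finsupp_def mem_Collect_eq by (rule finite_subset)
qed

lemma finsupp_scale:
  fixes a :: "nat \<Rightarrow> 'k::real_normed_field"
  assumes "a \<in> finsupp"
  shows "seq_scale c a \<in> finsupp"
proof -
  have "{n. seq_scale c a n \<noteq> 0} \<subseteq> {n. a n \<noteq> 0}"
    by (auto simp: fun_scale_def)
  then show ?thesis
    using assms unfolding finsupp_def mem_Collect_eq by (rule finite_subset)
qed

lemma finsupp_subset_ell: "finsupp \<subseteq> ell q"
proof
  fix a :: "nat \<Rightarrow> 'a"
  assume "a \<in> finsupp"
  then show "a \<in> ell q"
    unfolding finsupp_def ell_def mem_Collect_eq by (rule summable_finite) simp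
qed

lemma ell_norm_pos:
  fixes a :: "nat \<Rightarrow> 'k::real_normed_field"
  assumes "a \<in> ell q" "a \<noteq> 0"
  shows "ell_norm q a > 0"
proof -
  obtain i where "a i \<noteq> 0"
    using assms(2) by (auto simp: fun_eq_iff)
  then have "0 < (\<Sum>n. norm (a n) powr q)"
    using assms(1) by (intro suminf_pos2[of _ i]) (auto simp: ell_def)
  then show ?thesis
    by (simp add: ell_norm_def)
qed

text \<open>Nonnegativity turns both series into unconditional sums (\<open>has_sum\<close>). These
  can be evaluated row by row over pairs and then re-indexed along the bijection
  \<open>prod_decode\<close>.\<close>

lemma sums_prod_decode:
  fixes f g :: "nat \<Rightarrow> real"
  assumes f: "summable f" "\<And>n. 0 \<le> f n" and g: "summable g" "\<And>n. 0 \<le> g n"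
  shows "(\<lambda>n. f (fst (prod_decode n)) * g (snd (prod_decode n))) sums (suminf f * suminf g)"
proof -
  let ?h = "\<lambda>p. f (fst p) * g (snd p)"
  have F: "(f has_sum suminf f) UNIV" and G: "(g has_sum suminf g) UNIV"
    using f g by (auto intro: sums_nonneg_imp_has_sum summable_sums)
  have inner: "((\<lambda>j. ?h (i, j)) has_sum (f i * suminf g)) UNIV" for i
    using has_sum_cmult_right[OF G] by simp
  have outer: "((\<lambda>i. f i * suminf g) has_sum (suminf f * suminf g)) UNIV"
    by (rule has_sum_cmult_left[OF F])
  have "?h summable_on UNIV \<times> UNIV"
    using inner outer f g
    by (intro summable_on_SigmaI[where g = "\<lambda>i. f i * suminf g"]) (auto simp: summable_on_def)
  then have "(?h has_sum (suminf f * suminf g)) (UNIV \<times> UNIV)"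
    using inner outer by (intro has_sum_SigmaI[where g = "\<lambda>i. f i * suminf g"]) auto
  then have "((\<lambda>n. ?h (prod_decode n)) has_sum (suminf f * suminf g)) UNIV"
    by (subst has_sum_reindex_bij_betw[OF bij_prod_decode]) simp
  then show ?thesis
    by (rule has_sum_imp_sums)
qed

text \<open>The norm of the scalar field is multiplicative, so the series of \<open>q\<close>-th
  powers for \<open>tensor a y\<close> is the re-indexed product of the series for \<open>a\<close>
  and \<open>y\<close>.\<close>

lemma
  fixes a y :: "nat \<Rightarrow> 'k::real_normed_field"
  assumes a: "a \<in> ell q" and y: "y \<in> ell q"
  shows tensor_in_ell: "tensor a y \<in> ell q"
    and ell_norm_tensor: "ell_norm q (tensor a y) = ell_norm q a * ell_norm q y"
proof -
  have s: "(\<lambda>n. norm (tensor a y n) powr q)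
      sums ((\<Sum>n. norm (a n) powr q) * (\<Sum>n. norm (y n) powr q))"
    using sums_prod_decode[of "\<lambda>n. norm (a n) powr q" "\<lambda>n. norm (y n) powr q"] a y
    by (simp add: tensor_def norm_mult powr_mult ell_def)
  show "tensor a y \<in> ell q"
    using sums_summable[OF s] by (simp add: ell_def)
  show "ell_norm q (tensor a y) = ell_norm q a * ell_norm q y"
    using sums_unique[OF s, symmetric] a y
    by (simp add: ell_norm_def powr_mult suminf_nonneg ell_def)
qed

lemma
  fixes a b y z :: "nat \<Rightarrow> 'k::real_normed_field"
  shows tensor_add_left: "tensor (a + b) y = tensor a y + tensor b y"
    and tensor_add_right: "tensor a (y + z) = tensor a y + tensor a z"
    and tensor_scale_left: "tensor (seq_scale c a) y = seq_scale c (tensor a y)"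
    and tensor_scale_right: "tensor a (seq_scale c y) = seq_scale c (tensor a y)"
  by (auto simp: tensor_def fun_scale_def fun_eq_iff algebra_simps)

section \<open>Infinite-dimensional subspaces\<close>

text \<open>If \<open>V\<close> had a finite spanning set, the exchange bound would make a maximal
  independent subset of \<open>W\<close> finite, although it spans \<open>W\<close>.\<close>

lemma infinite_dimensional_mono:
  assumes "vector_space s" and W: "module.subspace s W" "infinite_dimensional s W" and "W \<subseteq> V"
  shows "infinite_dimensional s V"
  unfolding infinite_dimensional_def
proof
  interpret vector_space s by fact
  assume "\<exists>B. finite B \<and> span B = V"
  then obtain B where B: "finite B" "span B = V"
    by blast
  obtain C where C: "C \<subseteq> W" "independent C" "W \<subseteq> span C"
    by (rule maximal_independent_subset)
  have "finite C"
    using independent_span_bound[OF B(1) C(2)] C(1) B(2) \<open>W \<subseteq> V\<close> by auto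
  moreover have "span C = W"
    by (rule span_subspace[OF C(1) C(3) W(1)])
  ultimately show False
    using W(2) by (auto simp: infinite_dimensional_def)
qed

text \<open>Linearity of \<Phi> is required on \<open>finsupp\<close> only, because the embedding
  \<open>J\<close> behind it is constrained on \<open>ell q\<close> only.\<close>

lemma
  fixes s :: "'k::real_normed_field \<Rightarrow> 'v::ab_group_add \<Rightarrow> 'v"
  assumes s: "vector_space s"
    and add: "\<And>a b. a \<in> finsupp \<Longrightarrow> b \<in> finsupp \<Longrightarrow> \<Phi> (a + b) = \<Phi> a + \<Phi> b"
    and scale: "\<And>c a. a \<in> finsupp \<Longrightarrow> \<Phi> (seq_scale c a) = s c (\<Phi> a)"
  shows subspace_image_finsupp: "module.subspace s (\<Phi> ` finsupp)"
    and infinite_dimensional_image_finsupp: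
      "(\<And>a. a \<in> finsupp \<Longrightarrow> \<Phi> a = 0 \<Longrightarrow> a = 0) \<Longrightarrow> infinite_dimensional s (\<Phi> ` finsupp)"
proof -
  interpret vector_space s by fact
  \<comment> \<open>A general \<open>A\<close> serves two cases: \<open>finsupp\<close> itself and
    the sequences in it that vanish at one fixed coordinate.\<close>
  have subI: "subspace (\<Phi> ` A)"
    if A: "A \<subseteq> finsupp" "0 \<in> A" "\<And>a b. a \<in> A \<Longrightarrow> b \<in> A \<Longrightarrow> a + b \<in> A"
      "\<And>c a. a \<in> A \<Longrightarrow> seq_scale c a \<in> A" for A
  proof (rule subspaceI)
    have "\<Phi> (seq_scale 0 0) = 0"
      by (simp add: scale finsupp_zero)
    moreover have "seq_scale 0 0 = (0 :: nat \<Rightarrow> 'k)"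
      by (simp add: fun_scale_def fun_eq_iff)
    ultimately show "0 \<in> \<Phi> ` A"
      using A(2) by (metis image_eqI)
  next
    fix u v assume "u \<in> \<Phi> ` A" "v \<in> \<Phi> ` A"
    then obtain a b where "a \<in> A" "b \<in> A" "u = \<Phi> a" "v = \<Phi> b"
      by blast
    with A add[of a b] show "u + v \<in> \<Phi> ` A"
      by (metis image_eqI subsetD)
  next
    fix c u assume "u \<in> \<Phi> ` A"
    then obtain a where "a \<in> A" "u = \<Phi> a"
      by blast
    with A scale[of a c] show "s c u \<in> \<Phi> ` A"
      by (metis image_eqI subsetD)
  qed
  show "subspace (\<Phi> ` finsupp)"
    by (rule subI) (auto intro: finsupp_zero finsupp_add finsupp_scale)
  assume ker: "\<And>a. a \<in> finsupp \<Longrightarrow> \<Phi> a = 0 \<Longrightarrow> a = 0"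
  show "infinite_dimensional s (\<Phi> ` finsupp)"
    unfolding infinite_dimensional_def
  proof
    assume "\<exists>B. finite B \<and> span B = \<Phi> ` finsupp"
    then obtain B where B: "finite B" "span B = \<Phi> ` finsupp"
      by blast
    then have "B \<subseteq> \<Phi> ` finsupp"
      using span_superset by blast
    then obtain A where A: "A \<subseteq> finsupp" "finite A" "B = \<Phi> ` A"
      using finite_subset_image[OF B(1)] by metis
    \<comment> \<open>Finitely many generators have a common zero coordinate \<open>j\<close>, hence so has their span.\<close>
    have "finite (\<Union>a\<in>A. {n. a n \<noteq> 0})"
      using A by (auto simp: finsupp_def)
    then obtain j where j: "j \<notin> (\<Union>a\<in>A. {n. a n \<noteq> 0})"
      using ex_new_if_finite[OF infinite_UNIV_nat] by blast
    define Z where "Z = {a \<in> finsupp. a j = (0 :: 'k)}"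
    have "subspace (\<Phi> ` Z)"
      by (rule subI) (auto simp: Z_def fun_scale_def intro: finsupp_zero finsupp_add
          finsupp_scale[unfolded fun_scale_def])
    moreover have "B \<subseteq> \<Phi> ` Z"
      using A j by (auto simp: Z_def)
    ultimately have span: "span B \<subseteq> \<Phi> ` Z"
      by (intro span_minimal)
    \<comment> \<open>The unit sequence at \<open>j\<close> gives the contradiction: its image
      equals that of some \<open>a\<close> with \<open>a j = 0\<close>, so the trivial kernel forces
      \<open>e = a\<close>, while \<open>e j = 1\<close>.\<close>
    define e :: "nat \<Rightarrow> 'k" where "e = (\<lambda>n. if n = j then 1 else 0)"
    have e: "e \<in> finsupp"
      by (simp add: e_def finsupp_def)
    then obtain a where a: "a \<in> finsupp" "a j = 0" "\<Phi> e = \<Phi> a"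
      using span B(2) by (auto simp: Z_def)
    have "\<Phi> (e + seq_scale (-1) a) = 0"
      using a e by (simp add: add scale finsupp_scale)
    then have "e + seq_scale (-1) a = 0"
      using a e by (intro ker finsupp_add finsupp_scale)
    then have "(e + seq_scale (-1) a) j = 0"
      by simp
    then show False
      using a by (simp add: e_def fun_scale_def)
  qed
qed

section \<open>Norm attainment and the space of bounded operators\<close>

text \<open>Boundedness of \<open>T\<close> makes the supremum in \<open>operator_norm\<close> a
  genuine least upper bound. The criterion only compares values on the unit sphere, so a positive
  factor on them does not matter.\<close>

lemma norm_attaining_iff_max:
  assumes "T \<in> bounded_operators s W s' N"
  shows "T \<in> norm_attaining_operators s W s' N \<longleftrightarrow>
    (\<exists>v. norm v = 1 \<and> (\<forall>x. norm x = 1 \<longrightarrow> N (T x) \<le> N (T v)))"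
proof -
  let ?S = "{N (T x) |x. norm x = 1}"
  obtain K where K: "\<And>x. N (T x) \<le> K * norm x"
    using assms by (auto simp: bounded_operators_def)
  have "r \<le> K" if r: "r \<in> ?S" for r
  proof -
    obtain x where "norm x = 1" "r = N (T x)"
      using r by blast
    then show ?thesis
      using K[of x] by simp
  qed
  then have bdd: "bdd_above ?S"
    by (rule bdd_aboveI)
  have "N (T v) = Sup ?S \<longleftrightarrow> (\<forall>x. norm x = 1 \<longrightarrow> N (T x) \<le> N (T v))" if v: "norm v = 1" for v
  proof
    assume "N (T v) = Sup ?S"
    then show "\<forall>x. norm x = 1 \<longrightarrow> N (T x) \<le> N (T v)"
      using cSup_upper[OF _ bdd] by auto
  next
    assume "\<forall>x. norm x = 1 \<longrightarrow> N (T x) \<le> N (T v)"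
    then show "N (T v) = Sup ?S"
      using v by (intro cSup_eq_maximum[symmetric]) auto
  qed
  then show ?thesis
    using assms by (auto simp: norm_attaining_operators_def operator_norm_def)
qed

lemma bounded_operatorsI:
  assumes "vector_space s" "vector_space s'"
    and "\<And>x y. T (x + y) = T x + T y" "\<And>c x. T (s c x) = s' c (T x)"
    and "\<And>x. T x \<in> W" "\<And>x. N (T x) \<le> K * norm x"
  shows "T \<in> bounded_operators s W s' N"
  using assms unfolding bounded_operators_def Vector_Spaces.linear_iff by blast

lemma bounded_operatorsE:
  assumes "T \<in> bounded_operators s W s' N"
  obtains K where "\<And>x y. T (x + y) = T x + T y" "\<And>c x. T (s c x) = s' c (T x)"
    "\<And>x. T x \<in> W" "\<And>x. N (T x) \<le> K * norm x"
proof -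
  have "Vector_Spaces.linear s s' T" and range: "range T \<subseteq> W"
    and "\<exists>K. \<forall>x. N (T x) \<le> K * norm x"
    using assms by (simp_all add: bounded_operators_def)
  then obtain K where K: "\<And>x. N (T x) \<le> K * norm x"
    by blast
  interpret Vector_Spaces.linear s s' T
    by fact
  show thesis
    using range K by (intro that[of K]) (auto simp: add scale)
qed

text \<open>Lineability asks for an ambient vector space; this provides it, together with the zero
  operator as a bounded operator.\<close>

lemma subspace_bounded_operators:
  fixes sX :: "'k::real_normed_field \<Rightarrow> 'a::real_normed_vector \<Rightarrow> 'a"
    and sY :: "'k \<Rightarrow> 'b::banach \<Rightarrow> 'b"
  assumes sX: "vector_space sX" and sY: "banach_space_over sY"
  shows "module.subspace (fun_scale sY) (bounded_operators sX UNIV sY norm)"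
proof -
  interpret Y: banach_space_over sY by fact
  interpret F: vector_space "fun_scale sY :: _ \<Rightarrow> ('a \<Rightarrow> 'b) \<Rightarrow> _"
    by (rule vector_space_fun_scale) (rule Y.vector_space_axioms)
  show ?thesis
  proof (rule F.subspaceI)
    show "0 \<in> bounded_operators sX UNIV sY norm"
      by (rule bounded_operatorsI[OF sX Y.vector_space_axioms, where K = 0]) simp_all
  next
    fix S T assume S: "S \<in> bounded_operators sX UNIV sY norm"
      and T: "T \<in> bounded_operators sX UNIV sY norm"
    obtain K where K: "\<And>x y. S (x + y) = S x + S y" "\<And>c x. S (sX c x) = sY c (S x)"
        "\<And>x. norm (S x) \<le> K * norm x"
      using S by (rule bounded_operatorsE) (rule that)
    obtain L where L: "\<And>x y. T (x + y) = T x + T y" "\<And>c x. T (sX c x) = sY c (T x)"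
        "\<And>x. norm (T x) \<le> L * norm x"
      using T by (rule bounded_operatorsE) (rule that)
    show "S + T \<in> bounded_operators sX UNIV sY norm"
      by (rule bounded_operatorsI[OF sX Y.vector_space_axioms, where K = "K + L"])
        (simp_all add: K L Y.scale_right_distrib distrib_right norm_triangle_mono)
  next
    fix c T assume T: "T \<in> bounded_operators sX UNIV sY norm"
    obtain K where K: "\<And>x y. T (x + y) = T x + T y" "\<And>c x. T (sX c x) = sY c (T x)"
        "\<And>x. norm (T x) \<le> K * norm x"
      using T by (rule bounded_operatorsE) (rule that)
    show "fun_scale sY c T \<in> bounded_operators sX UNIV sY norm"
      by (rule bounded_operatorsI[OF sX Y.vector_space_axioms, where K = "norm c * K"])
        (simp_all add: K fun_scale_def Y.scale_right_distrib Y.scale_left_commute Y.norm_scale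
          mult.assoc mult_left_mono)
  qed
qed

section \<open>The operators built from one operator that does not attain its norm\<close>

theorem proposition7:
  fixes sX :: "'k::real_normed_field \<Rightarrow> 'a::banach \<Rightarrow> 'a"
    and sY :: "'k \<Rightarrow> 'b::banach \<Rightarrow> 'b"
    and q :: real
  assumes "banach_space_over sX"
    and "banach_space_over sY"
    and "\<exists>x::'a. x \<noteq> 0"
    and "1 \<le> q"
    and "\<exists>J. isometric_ell_embedding q sY J"
    and "bounded_operators sX (ell q) seq_scale (ell_norm q)
           \<noteq> norm_attaining_operators sX (ell q) seq_scale (ell_norm q)"
  shows "lineable_in (fun_scale sY)
           (bounded_operators sX UNIV sY norm)
           (bounded_operators sX UNIV sY norm - norm_attaining_operators sX UNIV sY norm)"
proof -
  interpret X: banach_space_over sX by fact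
  interpret Y: banach_space_over sY by fact
  let ?L = "bounded_operators sX UNIV sY norm"
  let ?NA = "norm_attaining_operators sX UNIV sY norm"
  have F: "vector_space (fun_scale sY :: _ \<Rightarrow> ('a \<Rightarrow> 'b) \<Rightarrow> _)"
    by (rule vector_space_fun_scale) (rule Y.vector_space_axioms)
  interpret F: vector_space "fun_scale sY :: _ \<Rightarrow> ('a \<Rightarrow> 'b) \<Rightarrow> _"
    by (rule F)
  obtain J where J: "isometric_ell_embedding q sY J"
    using assms(5) by blast
  have Jadd: "J (x + y) = J x + J y" if "x \<in> ell q" "y \<in> ell q" for x y
    using J that by (auto simp: isometric_ell_embedding_def)
  have Jscale: "J (seq_scale c x) = sY c (J x)" and Jnorm: "norm (J x) = ell_norm q x"
    if "x \<in> ell q" for x c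
    using J that by (auto simp: isometric_ell_embedding_def)
  \<comment> \<open>Norm-attaining operators are bounded by definition, so the two sets can differ
    only by a bounded operator outside the smaller one.\<close>
  obtain T where T: "T \<in> bounded_operators sX (ell q) seq_scale (ell_norm q)"
    and nonatt: "T \<notin> norm_attaining_operators sX (ell q) seq_scale (ell_norm q)"
    using assms(6) by (auto simp: norm_attaining_operators_def)
  obtain K where Tadd: "\<And>x y. T (x + y) = T x + T y"
    and Tscale: "\<And>c x. T (sX c x) = seq_scale c (T x)"
    and Tell: "\<And>x. T x \<in> ell q" and K: "\<And>x. ell_norm q (T x) \<le> K * norm x"
    using T by (rule bounded_operatorsE) (rule that)
  \<comment> \<open>The negated maximum criterion: no value of \<open>T\<close> on the unit sphere
    is largest.\<close>
  have larger: "\<exists>x. norm x = 1 \<and> ell_norm q (T v) < ell_norm q (T x)" if "norm v = 1" for v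
    using nonatt that by (auto simp: norm_attaining_iff_max[OF T] not_le)

  define \<Phi> where "\<Phi> a = (\<lambda>x. J (tensor a (T x)))" for a
  have ten: "tensor a (T x) \<in> ell q" if "a \<in> finsupp" for a x
    using that Tell finsupp_subset_ell by (blast intro: tensor_in_ell)
  have \<Phi>norm: "norm (\<Phi> a x) = ell_norm q a * ell_norm q (T x)" if "a \<in> finsupp" for a x
    using that Tell finsupp_subset_ell
    by (subst ell_norm_tensor[symmetric]) (auto simp: \<Phi>_def Jnorm ten)
  have \<Phi>add: "\<Phi> (a + b) = \<Phi> a + \<Phi> b" if "a \<in> finsupp" "b \<in> finsupp" for a b
    using that by (simp add: \<Phi>_def tensor_add_left fun_eq_iff Jadd ten)
  have \<Phi>scale: "\<Phi> (seq_scale c a) = fun_scale sY c (\<Phi> a)" if "a \<in> finsupp" for a c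
    using that by (simp add: \<Phi>_def tensor_scale_left fun_scale_def[of sY] fun_eq_iff Jscale ten)
  have \<Phi>L: "\<Phi> a \<in> ?L" if a: "a \<in> finsupp" for a
  proof (rule bounded_operatorsI[OF X.vector_space_axioms Y.vector_space_axioms])
    show "norm (\<Phi> a x) \<le> (ell_norm q a * K) * norm x" for x
      using K[of x] by (simp add: \<Phi>norm[OF a] mult.assoc mult_left_mono ell_norm_def)
    show "\<Phi> a (x + y) = \<Phi> a x + \<Phi> a y" for x y
      by (simp add: \<Phi>_def Tadd tensor_add_right Jadd ten[OF a])
    show "\<Phi> a (sX c x) = sY c (\<Phi> a x)" for c x
      by (simp add: \<Phi>_def Tscale tensor_scale_right Jscale ten[OF a])
  qed simp
  have \<Phi>NA: "\<Phi> a \<notin> ?NA" if a: "a \<in> finsupp" "a \<noteq> 0" for a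
  proof
    \<comment> \<open>Cancelling this positive factor turns a maximum point of
      \<Phi>\<open>a\<close> on the unit sphere into one of \<open>T\<close>.\<close>
    have pos: "0 < ell_norm q a"
      using a finsupp_subset_ell by (blast intro: ell_norm_pos)
    assume "\<Phi> a \<in> ?NA"
    then obtain v where "norm v = 1" and v: "\<And>x. norm x = 1 \<Longrightarrow> norm (\<Phi> a x) \<le> norm (\<Phi> a v)"
      unfolding norm_attaining_iff_max[OF \<Phi>L[OF a(1)]] by blast
    then obtain x where "norm x = 1" "ell_norm q (T v) < ell_norm q (T x)"
      using larger by blast
    then show False
      using v[of x] pos by (simp add: \<Phi>norm[OF a(1)])
  qed
  obtain x\<^sub>0 :: 'a where "x\<^sub>0 \<noteq> 0"
    using assms(3) by blast
  then have z: "norm (sgn x\<^sub>0) = 1"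
    by (simp add: norm_sgn)
  \<comment> \<open>A nonzero domain has a unit vector, at which the zero operator attains its norm.
    Hence \<Phi>\<open>a\<close>, which does not attain its norm for \<open>a\<close> nonzero,
    cannot be zero, and \<Phi> has trivial kernel.\<close>
  have zero_NA: "(0 :: 'a \<Rightarrow> 'b) \<in> ?NA"
  proof -
    have "(0 :: 'a \<Rightarrow> 'b) \<in> ?L"
      by (rule F.subspace_0[OF subspace_bounded_operators])
        (rule X.vector_space_axioms, rule assms(2))
    then show ?thesis
      using z by (subst norm_attaining_iff_max) auto
  qed
  have ker: "a = 0" if "a \<in> finsupp" "\<Phi> a = 0" for a
  proof (rule ccontr)
    assume "a \<noteq> 0"
    then show False
      using \<Phi>NA[OF that(1)] that(2) zero_NA by simp
  qed

  let ?W = "\<Phi> ` finsupp"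
  have W: "module.subspace (fun_scale sY) ?W"
    by (rule subspace_image_finsupp[OF F \<Phi>add \<Phi>scale])
  have Winf: "infinite_dimensional (fun_scale sY) ?W"
    by (rule infinite_dimensional_image_finsupp[OF F \<Phi>add \<Phi>scale ker])
  have "?W \<subseteq> (?L - ?NA) \<union> {0}"
  proof
    fix S assume "S \<in> ?W"
    then obtain a where a: "a \<in> finsupp" "S = \<Phi> a"
      by blast
    show "S \<in> (?L - ?NA) \<union> {0}"
    proof (cases "a = 0")
      case True
      \<comment> \<open>Here \<open>a + a = a\<close>, so additivity alone gives
        \<Phi>\<open>a = 0\<close>.\<close>
      then have "\<Phi> a = \<Phi> a + \<Phi> a"
        using \<Phi>add[OF a(1) a(1)] by simp
      then show ?thesis
        using a(2) by simp
    next
      case False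
      then show ?thesis
        using a \<Phi>L \<Phi>NA by auto
    qed
  qed
  moreover have "module.subspace (fun_scale sY) ?L"
    by (rule subspace_bounded_operators[OF X.vector_space_axioms assms(2)])
  moreover have "infinite_dimensional (fun_scale sY) ?L"
    using \<Phi>L by (intro infinite_dimensional_mono[OF F W Winf]) auto
  ultimately show ?thesis
    using W Winf F unfolding lineable_in_def by blast
qed

end
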